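(* Let $X$ be a complex Banach space and let $A,B,C\in\mathcal{B}(X)$ be such that $B$, $C$ and $CAB$ are regular. Then the following assertions are equivalent: (1) $A$ is $(B,C)$-invertible; (2) $A$ is $(B,C)$-polar; (3) there exist projections $P,Q\in\mathcal{B}(X)$ such that (i) $\mathcal{R}(P)=\mathcal{R}(B)$; (ii) $\mathcal{N}(Q)=\mathcal{N}(C)$; (iii) $\mathcal{R}(Q)=\mathcal{R}(AB)$; (iv) $\mathcal{N}(P)=\mathcal{N}(CA)$.
   Context: $\mathcal{B}(X)$ is the algebra of all bounded linear operators on $X$; for $T\in\mathcal{B}(X)$, $\mathcal{N}(T)$ is its null space and $\mathcal{R}(T)$ its range. A projection is an idempotent $P=P^2\in\mathcal{B}(X)$. $T\in\mathcal{B}(X)$ is regular if $T=TST$ for some $S\in\mathcal{B}(X)$. $A$ is $(B,C)$-invertible if there exists $Y\in B\mathcal{B}(X)\cap\mathcal{B}(X)C$ with $YAB=B$ and $CAY=C$. $A$ is $(B,C)$-polar if there exist projections $P,Q\in\mathcal{B}(X)$ such that $P\in B\mathcal{B}(X)CA$, $Q\in AB\mathcal{B}(X)C$, $PB=B$, $CQ=C$, $CAP=CA$ and $QAB=AB$. Here $B\mathcal{B}(X)CA=\{BTCA:T\in\mathcal{B}(X)\}$, and similarly for $AB\mathcal{B}(X)C$. *)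

theory Defs
  imports "HOL-Analysis.Analysis"
begin

class scaleC = scaleR +
  fixes scaleC :: "complex \<Rightarrow> 'a \<Rightarrow> 'a" (infixr "*\<^sub>C" 75)
  assumes scaleR_scaleC: "scaleR r x = scaleC (complex_of_real r) x"

class complex_vector = scaleC + ab_group_add +
  assumes scaleC_add_right: "a *\<^sub>C (x + y) = a *\<^sub>C x + a *\<^sub>C y"
    and scaleC_add_left: "(a + b) *\<^sub>C x = a *\<^sub>C x + b *\<^sub>C x"
    and scaleC_scaleC: "a *\<^sub>C (b *\<^sub>C x) = (a * b) *\<^sub>C x"
    and scaleC_one: "1 *\<^sub>C x = x"

class complex_normed_vector = complex_vector + real_normed_vector +
  assumes norm_scaleC: "norm (a *\<^sub>C x) = cmod a * norm x"

class complex_banach = complex_normed_vector + banach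

instantiation complex :: complex_banach
begin

definition scaleC_complex :: "complex \<Rightarrow> complex \<Rightarrow> complex"
  where "scaleC_complex a x = a * x"

instance
  by standard
    (simp_all add: scaleC_complex_def scaleR_conv_of_real algebra_simps norm_mult)

end

text \<open>The library's \<open>bounded_linear\<close> is real linearity with a norm bound, so only homogeneity over
  the complex scalars has to be added. Operators are plain functions, multiplied by \<open>\<circ>\<close>.\<close>

definition bounded_ops :: "('a::complex_banach \<Rightarrow> 'a) set"
  where "bounded_ops = {T. bounded_linear T \<and> (\<forall>c x. T (c *\<^sub>C x) = c *\<^sub>C T x)}"

definition null_space :: "('a::complex_banach \<Rightarrow> 'a) \<Rightarrow> 'a set"
  where "null_space T = {x. T x = 0}"

definition projection :: "('a::complex_banach \<Rightarrow> 'a) \<Rightarrow> bool"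
  where "projection P \<longleftrightarrow> P \<in> bounded_ops \<and> P \<circ> P = P"

definition regular_op :: "('a::complex_banach \<Rightarrow> 'a) \<Rightarrow> bool"
  where "regular_op T \<longleftrightarrow> T \<in> bounded_ops \<and> (\<exists>S\<in>bounded_ops. T = T \<circ> S \<circ> T)"

definition bc_invertible ::
    "('a::complex_banach \<Rightarrow> 'a) \<Rightarrow> ('a \<Rightarrow> 'a) \<Rightarrow> ('a \<Rightarrow> 'a) \<Rightarrow> bool"
  where "bc_invertible B C A \<longleftrightarrow>
    (\<exists>Y \<in> {B \<circ> T |T. T \<in> bounded_ops} \<inter> {T \<circ> C |T. T \<in> bounded_ops}.
      Y \<circ> A \<circ> B = B \<and> C \<circ> A \<circ> Y = C)"

definition bc_polar ::
    "('a::complex_banach \<Rightarrow> 'a) \<Rightarrow> ('a \<Rightarrow> 'a) \<Rightarrow> ('a \<Rightarrow> 'a) \<Rightarrow> bool"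
  where "bc_polar B C A \<longleftrightarrow>
    (\<exists>P Q. projection P \<and> projection Q \<and>
      P \<in> {B \<circ> T \<circ> C \<circ> A |T. T \<in> bounded_ops} \<and>
      Q \<in> {A \<circ> B \<circ> T \<circ> C |T. T \<in> bounded_ops} \<and>
      P \<circ> B = B \<and> C \<circ> Q = C \<and> C \<circ> A \<circ> P = C \<circ> A \<and> Q \<circ> A \<circ> B = A \<circ> B)"

end

theory Submission
  imports Defs
begin

text \<open>The link between the three conditions is that a \<open>(B, C)\<close>-inverse \<open>Y\<close> of \<open>A\<close> is an outer
  inverse, \<open>Y A Y = Y\<close>. Hence \<open>P = Y A\<close> and \<open>Q = A Y\<close> are idempotent, and writing \<open>Y = B T = S C\<close>
  one gets \<open>Y = Y A Y = B (T A S) C\<close>, which puts \<open>P\<close> and \<open>Q\<close> into the product sets that polarity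
  asks for. The equations and factorizations of polarity yield the four equalities of ranges and
  null spaces, one inclusion each.

  In the other direction, the range and null space conditions say that the space splits as
  \<open>\<R>(B) \<oplus> \<N>(C A)\<close> and as \<open>\<R>(A B) \<oplus> \<N>(C)\<close>. If \<open>D\<close> is an inner inverse of \<open>C A B\<close>, then
  \<open>Y = B D C\<close> is the \<open>(B, C)\<close>-inverse. Indeed, \<open>Y A B - B\<close> is killed on the left by \<open>C A\<close> and has
  range inside \<open>\<R>(B)\<close>, so the first splitting makes it zero; and \<open>C A Y - C\<close> is killed on the right
  by \<open>A B\<close> and vanishes on \<open>\<N>(C)\<close>, so the second splitting makes it zero.\<close>

lemma bounded_ops_comp:
  "S \<in> bounded_ops \<Longrightarrow> T \<in> bounded_ops \<Longrightarrow> S \<circ> T \<in> bounded_ops"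
  by (auto simp: bounded_ops_def comp_def intro: bounded_linear_compose)

lemma bounded_ops_linear: "T \<in> bounded_ops \<Longrightarrow> linear T"
  by (simp add: bounded_ops_def bounded_linear.linear)

lemma projection_fixes_range: "projection P \<Longrightarrow> x \<in> range P \<Longrightarrow> P x = x"
  by (auto simp: projection_def fun_eq_iff)

text \<open>An operator that factors both as \<open>B T\<close> and as \<open>S C\<close> need not have the form \<open>B U C\<close>; for
  a \<open>(B, C)\<close>-inverse the outer inverse property closes this gap.\<close>

lemma bc_invertible_imp_bc_polar:
  assumes A: "A \<in> bounded_ops" and B: "B \<in> bounded_ops" and inv: "bc_invertible B C A"
  shows "bc_polar B C A"
proof -
  obtain Y T S where T: "T \<in> bounded_ops" "Y = B \<circ> T" and S: "S \<in> bounded_ops" "Y = S \<circ> C"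
    and YAB: "Y \<circ> A \<circ> B = B" and CAY: "C \<circ> A \<circ> Y = C"
    using inv by (auto simp: bc_invertible_def)
  have apply_eqs: "Y (A (B x)) = B x" "C (A (Y x)) = C x" for x
    using YAB CAY by (simp_all add: fun_eq_iff)
  have outer: "Y (A (Y x)) = Y x" for x
    using apply_eqs(1)[of "T x"] by (simp add: T(2))
  define U where "U = T \<circ> A \<circ> S"
  have U: "U \<in> bounded_ops"
    using A T(1) S(1) by (simp add: U_def bounded_ops_comp)
  have Y: "Y \<in> bounded_ops"
    using B T by (simp add: bounded_ops_comp)
  have Y_fact: "Y = B \<circ> U \<circ> C"
  proof
    fix x
    have "Y (A (Y x)) = B (T (A (S (C x))))"
      using fun_cong[OF T(2)] fun_cong[OF S(2)] by simp
    then show "Y x = (B \<circ> U \<circ> C) x"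
      by (simp add: outer U_def)
  qed
  show ?thesis
    unfolding bc_polar_def
  proof (intro exI conjI)
    have "Y \<circ> A = B \<circ> U \<circ> C \<circ> A" "A \<circ> Y = A \<circ> B \<circ> U \<circ> C"
      by (simp_all only: Y_fact comp_assoc)
    then show "Y \<circ> A \<in> {B \<circ> T \<circ> C \<circ> A |T. T \<in> bounded_ops}"
      and "A \<circ> Y \<in> {A \<circ> B \<circ> T \<circ> C |T. T \<in> bounded_ops}"
      using U by blast+
    show "Y \<circ> A \<circ> B = B" by (fact YAB)
    show "C \<circ> (A \<circ> Y) = C" "C \<circ> A \<circ> (Y \<circ> A) = C \<circ> A" "A \<circ> Y \<circ> A \<circ> B = A \<circ> B"
      by (simp_all add: fun_eq_iff apply_eqs)
    show "projection (Y \<circ> A)" "projection (A \<circ> Y)"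
      using A Y by (simp_all add: projection_def bounded_ops_comp fun_eq_iff outer)
  qed
qed

lemma bc_polar_imp_splitting:
  assumes lin: "linear A" "linear B" "linear C" and polar: "bc_polar B C A"
  shows "\<exists>P Q. projection P \<and> projection Q \<and> range P = range B \<and> null_space Q = null_space C \<and>
    range Q = range (A \<circ> B) \<and> null_space P = null_space (C \<circ> A)"
proof -
  obtain P Q T U where proj: "projection P" "projection Q"
    and T: "T \<in> bounded_ops" "P = B \<circ> T \<circ> C \<circ> A"
    and U: "U \<in> bounded_ops" "Q = A \<circ> B \<circ> U \<circ> C"
    and eqs: "P \<circ> B = B" "C \<circ> Q = C" "C \<circ> A \<circ> P = C \<circ> A" "Q \<circ> A \<circ> B = A \<circ> B"
    using polar unfolding bc_polar_def by blast
  have zero: "A 0 = 0" "B 0 = 0" "C 0 = 0" "T 0 = 0" "U 0 = 0"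
    using lin T(1) U(1) by (simp_all add: bounded_ops_linear linear_0)
  have apply_eqs: "P (B x) = B x" "C (Q x) = C x" "C (A (P x)) = C (A x)" "Q (A (B x)) = A (B x)"
    for x
    using eqs by (simp_all add: fun_eq_iff)
  have fact: "P x = B (T (C (A x)))" "Q x = A (B (U (C x)))" for x
    by (simp_all add: T(2) U(2))
  show ?thesis
  proof (intro exI conjI)
    show "projection P" "projection Q" by (fact proj)+
    show "range P = range B"
    proof
      show "range P \<subseteq> range B" by (auto simp: fact(1))
      show "range B \<subseteq> range P" using apply_eqs(1) by (metis image_subsetI rangeI)
    qed
    show "range Q = range (A \<circ> B)"
    proof
      show "range Q \<subseteq> range (A \<circ> B)" by (auto simp: fact(2))
      show "range (A \<circ> B) \<subseteq> range Q" using apply_eqs(4) by (metis comp_apply image_subsetI rangeI)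
    qed
    show "null_space Q = null_space C"
    proof
      show "null_space Q \<subseteq> null_space C"
        unfolding null_space_def using apply_eqs(2) zero(3) by (metis (mono_tags) Collect_mono)
      show "null_space C \<subseteq> null_space Q"
        by (auto simp: null_space_def fact(2) zero)
    qed
    show "null_space P = null_space (C \<circ> A)"
    proof
      show "null_space P \<subseteq> null_space (C \<circ> A)"
        unfolding null_space_def comp_apply using apply_eqs(3) zero(1,3)
        by (metis (mono_tags) Collect_mono)
      show "null_space (C \<circ> A) \<subseteq> null_space P"
        by (auto simp: null_space_def fact(1) zero)
    qed
  qed
qed

text \<open>The two equations for \<open>Y = B D C\<close> rest on different halves of the splittings: \<open>Y A B = B\<close> on
  \<open>\<R>(P) \<inter> \<N>(P) = 0\<close>, and \<open>C A Y = C\<close> on \<open>\<R>(Q) + \<N>(Q) = X\<close>.\<close>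

lemma splitting_imp_bc_invertible:
  assumes ops: "A \<in> bounded_ops" "B \<in> bounded_ops" "C \<in> bounded_ops"
    and reg: "regular_op (C \<circ> A \<circ> B)"
    and proj: "projection P" "projection Q"
    and ranges: "range P = range B" "range Q = range (A \<circ> B)"
    and nulls: "null_space P = null_space (C \<circ> A)" "null_space Q = null_space C"
  shows "bc_invertible B C A"
proof -
  obtain D where D: "D \<in> bounded_ops" and "C \<circ> A \<circ> B = C \<circ> A \<circ> B \<circ> D \<circ> (C \<circ> A \<circ> B)"
    using reg by (auto simp: regular_op_def)
  then have inner: "C (A (B (D (C (A (B x)))))) = C (A (B x))" for x
    by (metis comp_apply)
  have lin: "linear A" "linear B" "linear C" "linear D" "linear P" "linear Q"
    using ops D proj by (auto simp: projection_def bounded_ops_linear)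
  have left: "B (D (C (A (B x)))) = B x" for x
  proof -
    \<comment> \<open>\<open>?z\<close> lies in the range and in the null space of \<open>P\<close>.\<close>
    let ?z = "B (D (C (A (B x)))) - B x"
    have "?z = B (D (C (A (B x))) - x)"
      using lin by (simp add: linear_diff)
    then have "P ?z = ?z"
      using ranges(1) proj(1) by (metis projection_fixes_range rangeI)
    moreover have "?z \<in> null_space (C \<circ> A)"
      using lin by (simp add: null_space_def linear_diff inner)
    then have "P ?z = 0"
      using nulls(1) by (auto simp: null_space_def)
    ultimately show ?thesis by simp
  qed
  have right: "C (A (B (D (C x)))) = C x" for x
  proof -
    have "Q x \<in> range (A \<circ> B)"
      unfolding ranges(2)[symmetric] by (rule rangeI)
    then obtain u where u: "Q x = A (B u)"
      by auto
    \<comment> \<open>Modulo \<open>\<N>(C)\<close>, every \<open>x\<close> equals the vector \<open>A (B u)\<close>, for which the inner inverse does the job.\<close>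
    have "Q (Q x) = Q x"
      using proj(2) rangeI by (rule projection_fixes_range)
    then have "x - Q x \<in> null_space Q"
      using lin by (simp add: null_space_def linear_diff)
    then have "C (x - Q x) = 0"
      using nulls(2) by (auto simp: null_space_def)
    then have "C x = C (A (B u))"
      using lin u by (simp add: linear_diff)
    then show ?thesis by (simp add: inner)
  qed
  define Y where "Y = B \<circ> D \<circ> C"
  have "Y = B \<circ> (D \<circ> C)" "D \<circ> C \<in> bounded_ops" "B \<circ> D \<in> bounded_ops"
    using ops D by (simp_all add: Y_def comp_assoc bounded_ops_comp)
  then have "Y \<in> {B \<circ> T |T. T \<in> bounded_ops}" "Y \<in> {T \<circ> C |T. T \<in> bounded_ops}"
    unfolding Y_def by blast+
  moreover have "Y \<circ> A \<circ> B = B" "C \<circ> A \<circ> Y = C"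
    by (simp_all add: Y_def fun_eq_iff left right)
  ultimately show ?thesis
    unfolding bc_invertible_def by blast
qed

theorem theorem4p1:
  fixes A B C :: "'a::complex_banach \<Rightarrow> 'a"
  assumes "A \<in> bounded_ops" and "B \<in> bounded_ops" and "C \<in> bounded_ops"
    and "regular_op B" and "regular_op C" and "regular_op (C \<circ> A \<circ> B)"
  shows "(bc_invertible B C A \<longleftrightarrow> bc_polar B C A) \<and>
    (bc_polar B C A \<longleftrightarrow>
      (\<exists>P Q. projection P \<and> projection Q \<and>
        range P = range B \<and>
        null_space Q = null_space C \<and>
        range Q = range (A \<circ> B) \<and>
        null_space P = null_space (C \<circ> A)))"
    (is "(?inv \<longleftrightarrow> ?polar) \<and> (?polar \<longleftrightarrow> ?split)")
proof -
  have "?inv \<Longrightarrow> ?polar"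
    using assms(1,2) by (rule bc_invertible_imp_bc_polar)
  moreover have "?polar \<Longrightarrow> ?split"
    using assms(1-3)[THEN bounded_ops_linear] by (rule bc_polar_imp_splitting)
  moreover have "?split \<Longrightarrow> ?inv"
    using assms(1-3,6) by (blast intro: splitting_imp_bc_invertible)
  ultimately show ?thesis by blast
qed

end
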